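(* Let $X$ and $Y$ be Banach spaces, either both real or both complex, with $X$ reflexive. Let $T, A : X \to Y$ be compact linear operators, and suppose that there is $x_0 \in S_X$ such that $M_T = \{ x_0, -x_0 \}$ in the real case, and $M_T = \{ e^{i\theta} x_0 : \theta \in [0, 2\pi) \}$ in the complex case. Then $T \perp_B A$ (in the space of bounded linear operators from $X$ to $Y$ with the operator norm) if and only if $\mathcal{O}_{T,A} \cap M_T \neq \emptyset$.
   Context: $S_X = \{x \in X : \|x\| = 1\}$ is the unit sphere. In a normed space over $\mathbb{K} \in \{\mathbb{R}, \mathbb{C}\}$, $x$ is Birkhoff-James orthogonal to $y$, written $x \perp_B y$, if $\|x\| \le \|x + \lambda y\|$ for all $\lambda \in \mathbb{K}$. For bounded linear operators $T, A : X \to Y$: the norm attainment set of $T$ is $M_T = \{x \in S_X : \|Tx\| = \|T\|\}$, and $\mathcal{O}_{T,A} = \{x \in S_X : Tx \perp_B Ax\}$. *)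

theory Defs
  imports "HOL-Analysis.Analysis"
begin

text \<open>
  The type classes \<open>real_normed_vector\<close> and \<open>banach\<close> only provide real scalars. A normed space over
  \<open>'k\<close> (used with \<open>'k\<close> being \<open>real\<close> or \<open>complex\<close>) is a type of class \<open>real_normed_vector\<close> together
  with a scalar multiplication by \<open>'k\<close> that extends the one by reals and is compatible with the norm.
  Over \<open>real\<close> the only possibility is \<open>scaleR\<close>.
\<close>

locale normed_space_over = vector_space scl
  for scl :: "'k::real_normed_field \<Rightarrow> 'a::real_normed_vector \<Rightarrow> 'a" +
  assumes scale_of_real: "scl (of_real r) x = r *\<^sub>R x"
    and norm_scale: "norm (scl c x) = norm c * norm x"

definition birkhoff_orth ::
    "('k \<Rightarrow> 'a \<Rightarrow> 'a) \<Rightarrow> 'a::real_normed_vector \<Rightarrow> 'a \<Rightarrow> bool"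
  where "birkhoff_orth scl x y \<longleftrightarrow> (\<forall>c. norm x \<le> norm (x + scl c y))"

text \<open>
  The scalar multiplication by \<open>'k\<close> on bounded operators induced by the one on the codomain.
  Elements of \<open>'a \<Rightarrow>\<^sub>L 'b\<close> are only required to be real linear; linearity over \<open>'k\<close> is expressed
  separately by \<open>Vector_Spaces.linear\<close>. The operator norm is the same in both cases.
\<close>

definition op_scale ::
    "('k \<Rightarrow> 'b \<Rightarrow> 'b) \<Rightarrow> 'k \<Rightarrow> ('a::real_normed_vector \<Rightarrow>\<^sub>L 'b::real_normed_vector) \<Rightarrow> ('a \<Rightarrow>\<^sub>L 'b)"
  where "op_scale scl c T = Blinfun (\<lambda>x. scl c (blinfun_apply T x))"

definition compact_operator ::
    "('a::real_normed_vector \<Rightarrow>\<^sub>L 'b::real_normed_vector) \<Rightarrow> bool"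
  where "compact_operator T \<longleftrightarrow> (\<forall>S. bounded S \<longrightarrow> compact (closure (blinfun_apply T ` S)))"

definition norm_attainment_set ::
    "('a::real_normed_vector \<Rightarrow>\<^sub>L 'b::real_normed_vector) \<Rightarrow> 'a set"
  where "norm_attainment_set T = {x \<in> sphere 0 1. norm (blinfun_apply T x) = norm T}"

definition orth_set ::
    "('k \<Rightarrow> 'b \<Rightarrow> 'b) \<Rightarrow> ('a::real_normed_vector \<Rightarrow>\<^sub>L 'b::real_normed_vector) \<Rightarrow> ('a \<Rightarrow>\<^sub>L 'b) \<Rightarrow> 'a set"
  where "orth_set scl T A =
    {x \<in> sphere 0 1. birkhoff_orth scl (blinfun_apply T x) (blinfun_apply A x)}"

definition dual_space ::
    "('k::real_normed_field \<Rightarrow> 'a::real_normed_vector \<Rightarrow> 'a) \<Rightarrow> ('a \<Rightarrow>\<^sub>L 'k) set"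
  where "dual_space scl = {f. Vector_Spaces.linear scl (*) (blinfun_apply f)}"

text \<open>
  The bounded linear functionals on the dual space. The dual is in general a proper subset of the type
  \<open>'a \<Rightarrow>\<^sub>L 'k\<close>, so only the values of \<open>\<phi>\<close> on that subset are constrained.
\<close>

definition bidual_functional ::
    "('k::real_normed_field \<Rightarrow> 'a::real_normed_vector \<Rightarrow> 'a) \<Rightarrow> (('a \<Rightarrow>\<^sub>L 'k) \<Rightarrow> 'k) \<Rightarrow> bool"
  where "bidual_functional scl \<phi> \<longleftrightarrow>
    (\<forall>f \<in> dual_space scl. \<forall>g \<in> dual_space scl. \<phi> (f + g) = \<phi> f + \<phi> g) \<and>
    (\<forall>c. \<forall>f \<in> dual_space scl. \<phi> (op_scale (*) c f) = c * \<phi> f) \<and>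
    (\<exists>B. \<forall>f \<in> dual_space scl. norm (\<phi> f) \<le> B * norm f)"

text \<open>Surjectivity of the canonical embedding into the bidual.\<close>

definition reflexive_space ::
    "('k::real_normed_field \<Rightarrow> 'a::real_normed_vector \<Rightarrow> 'a) \<Rightarrow> bool"
  where "reflexive_space scl \<longleftrightarrow>
    (\<forall>\<phi>. bidual_functional scl \<phi> \<longrightarrow>
      (\<exists>x. \<forall>f \<in> dual_space scl. \<phi> f = blinfun_apply f x))"

lemma normed_space_over_scaleR:
  "normed_space_over (scaleR :: real \<Rightarrow> 'a::real_normed_vector \<Rightarrow> 'a)"
  by unfold_locales (auto simp: algebra_simps)

lemma normed_space_over_mult:
  "normed_space_over ((*) :: 'k::real_normed_field \<Rightarrow> 'k \<Rightarrow> 'k)"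
  by unfold_locales (auto simp: algebra_simps scaleR_conv_of_real norm_mult)

context normed_space_over
begin

lemma bounded_linear_scale: "bounded_linear (scl c)"
proof (rule bounded_linear_intro)
  fix x y r
  show "scl c (x + y) = scl c x + scl c y"
    by (rule scale_right_distrib)
  show "scl c (r *\<^sub>R x) = r *\<^sub>R scl c x"
    by (metis scale_left_commute scale_of_real)
  show "norm (scl c x) \<le> norm x * norm c"
    by (simp add: norm_scale mult.commute)
qed

lemma blinfun_apply_op_scale:
  "blinfun_apply (op_scale scl c T) x = scl c (blinfun_apply T x)"
  unfolding op_scale_def
  by (subst bounded_linear_Blinfun_apply)
    (auto intro: bounded_linear_compose[OF bounded_linear_scale] blinfun.bounded_linear_right)

lemma norm_op_scale: "norm (op_scale scl c T) = norm c * norm T"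
proof -
  have le: "norm (op_scale scl d S) \<le> norm d * norm S"
    for d and S :: "'c::real_normed_vector \<Rightarrow>\<^sub>L 'a"
    by (rule norm_blinfun_bound)
      (auto simp: blinfun_apply_op_scale norm_scale mult.assoc intro!: mult_left_mono norm_blinfun)
  show ?thesis
  proof (cases "c = 0")
    case True
    then show ?thesis using le[of c T] by simp
  next
    case False
    have "op_scale scl (inverse c) (op_scale scl c T) = T"
      using False by (intro blinfun_eqI) (simp add: blinfun_apply_op_scale)
    then have "norm T \<le> inverse (norm c) * norm (op_scale scl c T)"
      using le[of "inverse c" "op_scale scl c T"] False by (simp add: norm_inverse)
    then have "norm c * norm T \<le> norm (op_scale scl c T)"
      using False by (simp add: field_simps)
    with le[of c T] show ?thesis by simp
  qed
qed

lemma normed_space_over_op_scale: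
  "normed_space_over (op_scale scl :: 'k \<Rightarrow> ('c::real_normed_vector \<Rightarrow>\<^sub>L 'a) \<Rightarrow> _)"
  by unfold_locales
    (auto intro!: blinfun_eqI simp: blinfun_apply_op_scale blinfun.add_left blinfun.scaleR_left
      scale_right_distrib scale_left_distrib scale_of_real norm_op_scale)

end

end

theory Submission
  imports Defs
begin

section \<open>Sublinear functionals and their tilts\<close>

text \<open>Homogeneity is only an inequality for positive factors, which is easy to check for tilts
  and infima; using it for \<open>r\<close> and \<open>inverse r\<close> gives equality.\<close>

definition sublinear_functional :: "('a::real_vector \<Rightarrow> real) \<Rightarrow> bool"
  where "sublinear_functional q \<longleftrightarrow>
    (\<forall>x y. q (x + y) \<le> q x + q y) \<and> (\<forall>r>0. \<forall>x. q (r *\<^sub>R x) \<le> r * q x)"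

lemma sublinear_functionalI:
  assumes "\<And>x y. q (x + y) \<le> q x + q y" and "\<And>r x. r > 0 \<Longrightarrow> q (r *\<^sub>R x) \<le> r * q x"
  shows "sublinear_functional q"
  using assms by (auto simp: sublinear_functional_def)

lemma sublinear_functional_add: "sublinear_functional q \<Longrightarrow> q (x + y) \<le> q x + q y"
  by (simp add: sublinear_functional_def)

lemma sublinear_functional_zero:
  assumes "sublinear_functional q"
  shows "q 0 = 0"
proof -
  \<comment> \<open>Halving gives \<open>q 0 \<le> 0\<close>; subadditivity at \<open>0 + 0\<close>
    gives the converse.\<close>
  have "q ((1/2) *\<^sub>R 0) \<le> (1/2) * q 0"
    using assms unfolding sublinear_functional_def by (metis half_gt_zero zero_less_one)
  then show ?thesis
    using sublinear_functional_add[OF assms, of 0 0] by simp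
qed

lemma sublinear_functional_scaleR:
  assumes "sublinear_functional q" and "r \<ge> 0"
  shows "q (r *\<^sub>R x) = r * q x"
proof (cases "r = 0")
  case True
  then show ?thesis using sublinear_functional_zero[OF assms(1)] by simp
next
  case False
  with assms have r: "r > 0" by simp
  have le: "q (s *\<^sub>R z) \<le> s * q z" if "s > 0" for s z
    using assms(1) that by (simp add: sublinear_functional_def)
  have "q x \<le> inverse r * q (r *\<^sub>R x)"
    using le[of "inverse r" "r *\<^sub>R x"] r by simp
  then have "r * q x \<le> q (r *\<^sub>R x)"
    using r by (simp add: field_simps)
  with le[OF r, of x] show ?thesis by simp
qed

text \<open>Any sublinear functional below \<open>p\<close> is therefore at least
  \<open>- p (- x)\<close> at \<open>x\<close>, which keeps pointwise infima finite.\<close>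

lemma sublinear_functional_lower: "sublinear_functional q \<Longrightarrow> - q (- x) \<le> q x"
  using sublinear_functional_add[of q x "- x"] sublinear_functional_zero[of q] by simp

lemma sublinear_functional_norm: "sublinear_functional norm"
  by (rule sublinear_functionalI) (auto simp: norm_triangle_ineq)

text \<open>
  Hahn-Banach without extending functionals from subspaces: a minimal sublinear functional equals all
  its tilts, which forces it to be odd and hence linear. Minimising below \<open>tilt norm v\<close> instead of
  \<open>norm\<close> makes the resulting functional attain its norm at \<open>v\<close>.
\<close>

definition tilt :: "('a::real_vector \<Rightarrow> real) \<Rightarrow> 'a \<Rightarrow> 'a \<Rightarrow> real"
  where "tilt q y x = (INF t\<in>{0..}. q (x + t *\<^sub>R y) - t * q y)"

context
  fixes q :: "'a::real_vector \<Rightarrow> real"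
  assumes q: "sublinear_functional q"
begin

lemma tilt_le:
  assumes "t \<ge> 0"
  shows "tilt q y x \<le> q (x + t *\<^sub>R y) - t * q y"
  unfolding tilt_def
proof (rule cINF_lower)
  show "bdd_below ((\<lambda>t. q (x + t *\<^sub>R y) - t * q y) ` {0..})"
  \<comment> \<open>The bound \<open>- q (- x)\<close> does not depend on \<open>t\<close>;
    boundedness is what makes the real-valued \<open>INF\<close> an actual lower bound.\<close>
  proof (rule bdd_belowI2)
    fix t :: real
    assume "t \<in> {0..}"
    then have "t * q y = q (t *\<^sub>R y)"
      using sublinear_functional_scaleR[OF q] by simp
    also have "\<dots> \<le> q (x + t *\<^sub>R y) + q (- x)"
      using sublinear_functional_add[OF q, of "x + t *\<^sub>R y" "- x"] by simp
    finally show "- q (- x) \<le> q (x + t *\<^sub>R y) - t * q y" by simp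
  qed
qed (use assms in auto)

lemma tilt_greatest:
  "(\<And>t. t \<ge> 0 \<Longrightarrow> m \<le> q (x + t *\<^sub>R y) - t * q y) \<Longrightarrow> m \<le> tilt q y x"
  unfolding tilt_def by (rule cINF_greatest) auto

lemma tilt_le_self: "tilt q y x \<le> q x"
  using tilt_le[of 0 y x] by simp

text \<open>The choice \<open>t = 1\<close> cancels the argument and leaves the inequality that
  later forces oddness.\<close>

lemma tilt_minus: "tilt q y (- y) \<le> - q y"
  using tilt_le[of 1 y "- y"] sublinear_functional_zero[OF q] by simp

lemma sublinear_functional_tilt: "sublinear_functional (tilt q y)"
proof (rule sublinear_functionalI)
  fix x z
  \<comment> \<open>Parameters \<open>s\<close> for \<open>x\<close> and \<open>t\<close> for
    \<open>z\<close> merge into \<open>s + t\<close> for \<open>x + z\<close>; the two infima are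
    then taken one after the other.\<close>
  have "tilt q y (x + z) - (q (z + t *\<^sub>R y) - t * q y) \<le> tilt q y x" if t: "t \<ge> 0" for t
  proof (rule tilt_greatest)
    fix s :: real
    assume s: "s \<ge> 0"
    have "tilt q y (x + z) \<le> q ((x + s *\<^sub>R y) + (z + t *\<^sub>R y)) - (s + t) * q y"
      using tilt_le[of "s + t" y "x + z"] s t by (simp add: algebra_simps)
    also have "\<dots> \<le> q (x + s *\<^sub>R y) + q (z + t *\<^sub>R y) - (s + t) * q y"
      using sublinear_functional_add[OF q] by simp
    finally show "tilt q y (x + z) - (q (z + t *\<^sub>R y) - t * q y) \<le> q (x + s *\<^sub>R y) - s * q y"
      by (simp add: algebra_simps)
  qed
  then have "tilt q y (x + z) - tilt q y x \<le> tilt q y z"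
    by (intro tilt_greatest) (simp add: algebra_simps)
  then show "tilt q y (x + z) \<le> tilt q y x + tilt q y z" by simp
next
  fix r :: real and x
  assume r: "r > 0"
  have "tilt q y (r *\<^sub>R x) / r \<le> tilt q y x"
  proof (rule tilt_greatest)
    fix t :: real
    assume t: "t \<ge> 0"
    have "tilt q y (r *\<^sub>R x) \<le> q (r *\<^sub>R (x + t *\<^sub>R y)) - (r * t) * q y"
      using tilt_le[of "r * t" y "r *\<^sub>R x"] r t by (simp add: algebra_simps)
    also have "\<dots> = r * (q (x + t *\<^sub>R y) - t * q y)"
      using sublinear_functional_scaleR[OF q, of r] r by (simp add: right_diff_distrib)
    finally show "tilt q y (r *\<^sub>R x) / r \<le> q (x + t *\<^sub>R y) - t * q y"
      using r by (simp add: field_simps)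
  qed
  then show "tilt q y (r *\<^sub>R x) \<le> r * tilt q y x"
    using r by (simp add: field_simps)
qed

end

section \<open>Zorn's lemma and the real Hahn-Banach theorem\<close>

text \<open>Subadditivity survives the infimum because any \<open>q\<close> and \<open>r\<close> in
  a chain lie above a common member \<open>s\<close>, so that
  \<open>s x + s y \<le> q x + r y\<close>.\<close>

lemma sublinear_functional_INF_chain:
  assumes ne: "C \<noteq> {}" and sub: "\<And>q. q \<in> C \<Longrightarrow> sublinear_functional q"
    and le: "\<And>q. q \<in> C \<Longrightarrow> q \<le> p" and chain: "\<And>q r. q \<in> C \<Longrightarrow> r \<in> C \<Longrightarrow> q \<le> r \<or> r \<le> q"
  shows "sublinear_functional (\<lambda>x. INF q\<in>C. q x)" and "\<And>q x. q \<in> C \<Longrightarrow> (INF q\<in>C. q x) \<le> q x"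
proof -
  show lower: "(INF q\<in>C. q x) \<le> q x" if "q \<in> C" for q x
  proof (rule cINF_lower)
    have "- p (- x) \<le> r x" if "r \<in> C" for r
      using sublinear_functional_lower[OF sub[OF that], of x] le[OF that]
      by (meson le_funD le_imp_neg_le order_trans)
    then show "bdd_below ((\<lambda>q. q x) ` C)" by (rule bdd_belowI2)
  qed fact
  show "sublinear_functional (\<lambda>x. INF q\<in>C. q x)"
  proof (rule sublinear_functionalI)
    fix x y
    have *: "(INF q\<in>C. q (x + y)) \<le> q x + r y" if q: "q \<in> C" and r: "r \<in> C" for q r
    proof -
      obtain s where s: "s \<in> C" "s \<le> q" "s \<le> r"
        using chain[OF q r] q r by blast
      have "(INF q\<in>C. q (x + y)) \<le> s (x + y)" by (rule lower[OF s(1)])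
      also have "\<dots> \<le> s x + s y" by (rule sublinear_functional_add[OF sub[OF s(1)]])
      also have "\<dots> \<le> q x + r y" using s(2,3) by (simp add: add_mono le_funD)
      finally show ?thesis .
    qed
    have "(INF q\<in>C. q (x + y)) - r y \<le> (INF q\<in>C. q x)" if "r \<in> C" for r
      using *[OF _ that] by (intro cINF_greatest[OF ne]) (simp add: algebra_simps)
    then have "(INF q\<in>C. q (x + y)) - (INF q\<in>C. q x) \<le> (INF q\<in>C. q y)"
      by (intro cINF_greatest[OF ne]) (simp add: algebra_simps)
    then show "(INF q\<in>C. q (x + y)) \<le> (INF q\<in>C. q x) + (INF q\<in>C. q y)" by simp
  next
    fix r :: real and x
    assume r: "r > 0"
    have "(INF q\<in>C. q (r *\<^sub>R x)) / r \<le> (INF q\<in>C. q x)"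
    proof (rule cINF_greatest[OF ne])
      fix q assume "q \<in> C"
      then show "(INF q\<in>C. q (r *\<^sub>R x)) / r \<le> q x"
        using lower[of q "r *\<^sub>R x"] sublinear_functional_scaleR[OF sub, of q r x] r
        by (simp add: field_simps)
    qed
    then show "(INF q\<in>C. q (r *\<^sub>R x)) \<le> r * (INF q\<in>C. q x)"
      using r by (simp add: field_simps)
  qed
qed

lemma exists_minimal_sublinear_functional:
  assumes p: "sublinear_functional p"
  obtains q where "sublinear_functional q" "q \<le> p"
    "\<And>r. sublinear_functional r \<Longrightarrow> r \<le> q \<Longrightarrow> r = q"
proof -
  define S where "S = {q. sublinear_functional q \<and> q \<le> p}"
  \<comment> \<open>The order is reversed: maximal elements are minimal functionals, and a nonempty
    chain is bounded by its pointwise infimum.\<close>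
  have "\<exists>m\<in>S. \<forall>a\<in>S. m \<ge> a \<longrightarrow> a = m"
  proof (rule predicate_Zorn)
    show "partial_order_on S (relation_of (\<ge>) S)"
      by (rule partial_order_on_relation_ofI) auto
  next
    fix C
    assume C: "C \<in> Chains (relation_of (\<ge>) S)"
    show "\<exists>u\<in>S. \<forall>a\<in>C. a \<ge> u"
    proof (cases "C = {}")
      case True
      then show ?thesis using p by (auto simp: S_def)
    next
      case False
      have sub: "sublinear_functional q" "q \<le> p" if "q \<in> C" for q
        using Chains_relation_of[OF C] that by (auto simp: S_def)
      have "q \<le> r \<or> r \<le> q" if "q \<in> C" "r \<in> C" for q r
        using C that by (auto simp: Chains_def relation_of_def)
      then have INF: "sublinear_functional (\<lambda>x. INF q\<in>C. q x)"
          "(INF q\<in>C. q x) \<le> q x" if "q \<in> C" for q x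
        using sublinear_functional_INF_chain[of C p] False sub that by blast+
      have low: "(\<lambda>x. INF q\<in>C. q x) \<le> q" if "q \<in> C" for q
        using INF(2)[OF that] by (rule le_funI)
      moreover have "(\<lambda>x. INF q\<in>C. q x) \<in> S"
        using INF(1) low sub(2) False unfolding S_def by (blast intro: order_trans)
      ultimately show ?thesis by blast
    qed
  qed
  then show thesis
    using that unfolding S_def by (auto intro: order_trans)
qed

lemma minimal_sublinear_functional_linear:
  assumes q: "sublinear_functional q"
    and min: "\<And>r. sublinear_functional r \<Longrightarrow> r \<le> q \<Longrightarrow> r = q"
  shows "linear q"
proof -
  have minus: "q (- y) = - q y" for y
  proof -
    have "tilt q y = q"
      by (intro min sublinear_functional_tilt[OF q] le_funI tilt_le_self[OF q])
    then show ?thesis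
      using tilt_minus[OF q, of y] sublinear_functional_lower[OF q, of "- y"] by simp
  qed
  show ?thesis
  proof (rule linearI)
    fix x y
    \<comment> \<open>By oddness, subadditivity for \<open>x = (x + y) + (- y)\<close> is the
      reverse inequality.\<close>
    show "q (x + y) = q x + q y"
      using sublinear_functional_add[OF q, of x y] sublinear_functional_add[OF q, of "x + y" "- y"]
      by (simp add: minus)
  next
    fix r x
    show "q (r *\<^sub>R x) = r *\<^sub>R q x"
    proof (cases "r \<ge> 0")
      case True
      then show ?thesis by (simp add: sublinear_functional_scaleR[OF q])
    next
      case False
      then show ?thesis
        using sublinear_functional_scaleR[OF q, of "- r" x] minus[of "r *\<^sub>R x"] by simp
    qed
  qed
qed

lemma exists_real_norming_functional:
  fixes v :: "'a::real_normed_vector"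
  obtains f :: "'a \<Rightarrow> real" where "linear f" "\<And>x. \<bar>f x\<bar> \<le> norm x" "f v = norm v"
proof -
  obtain f where f: "sublinear_functional f" "f \<le> tilt norm v"
    and min: "\<And>r. sublinear_functional r \<Longrightarrow> r \<le> f \<Longrightarrow> r = f"
    using exists_minimal_sublinear_functional[OF sublinear_functional_tilt[OF sublinear_functional_norm]]
    by metis
  have lin: "linear f"
    by (rule minimal_sublinear_functional_linear[OF f(1) min])
  have le: "f x \<le> norm x" for x
    using le_funD[OF f(2)] tilt_le_self[OF sublinear_functional_norm] by (rule order_trans)
  have "\<bar>f x\<bar> \<le> norm x" for x
    using le[of x] le[of "- x"] linear_neg[OF lin, of x] by simp
  moreover have "f (- v) \<le> - norm v"
    using le_funD[OF f(2)] tilt_minus[OF sublinear_functional_norm] by (rule order_trans)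
  then have "f v = norm v"
    using le[of v] linear_neg[OF lin, of v] by simp
  ultimately show thesis using that lin by blast
qed

section \<open>Norming functionals over real and complex scalars\<close>

text \<open>The consequence of Hahn-Banach through which the later arguments become uniform in the
  scalar field. Requiring \<open>norm f \<le> 1\<close> instead of equality also admits the trivial
  space.\<close>

definition norming_dual ::
    "('k::real_normed_field \<Rightarrow> 'a::real_normed_vector \<Rightarrow> 'a) \<Rightarrow> bool"
  where "norming_dual scl \<longleftrightarrow>
    (\<forall>v. \<exists>f \<in> dual_space scl. norm f \<le> 1 \<and> norm v \<le> norm (blinfun_apply f v))"

lemma norming_dual_real: "norming_dual (scaleR :: real \<Rightarrow> 'a::real_normed_vector \<Rightarrow> 'a)"
  unfolding norming_dual_def
proof
  fix v :: 'a
  obtain f :: "'a \<Rightarrow> real" where f: "linear f" "\<And>x. \<bar>f x\<bar> \<le> norm x" "f v = norm v"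
    using exists_real_norming_functional by blast
  have "bounded_linear f"
    using f by (intro bounded_linear_intro[where K = 1]) (auto simp: linear_add linear_scale)
  then have app: "blinfun_apply (Blinfun f) = f"
    by (rule bounded_linear_Blinfun_apply)
  have "Vector_Spaces.linear (scaleR :: real \<Rightarrow> 'a \<Rightarrow> 'a) (*) f"
    using f(1) by (simp add: linear_def real_scaleR_def[abs_def])
  then show "\<exists>f \<in> dual_space (scaleR :: real \<Rightarrow> 'a \<Rightarrow> 'a).
      norm f \<le> 1 \<and> norm v \<le> norm (blinfun_apply f v)"
    using f by (intro bexI[of _ "Blinfun f"]) (auto simp: dual_space_def app intro!: norm_blinfun_bound)
qed

text \<open>A complex-linear \<open>f\<close> is determined by its real part:
  \<open>f (scl \<i> x) = \<i> * f x\<close> forces the imaginary part at \<open>x\<close> to be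
  minus the real part at \<open>scl \<i> x\<close>. The real part is taken to be a real norming
  functional \<open>u\<close>.\<close>

lemma norming_dual_complex:
  fixes scl :: "complex \<Rightarrow> 'a::real_normed_vector \<Rightarrow> 'a"
  assumes "normed_space_over scl"
  shows "norming_dual scl"
  unfolding norming_dual_def
proof
  interpret normed_space_over scl by fact
  fix v :: 'a
  obtain u :: "'a \<Rightarrow> real" where u: "linear u" "\<And>x. \<bar>u x\<bar> \<le> norm x" "u v = norm v"
    using exists_real_norming_functional by blast
  define f where "f x = Complex (u x) (- u (scl \<i> x))" for x
  have add: "f (x + y) = f x + f y" for x y
    by (simp add: f_def linear_add[OF u(1)] scale_right_distrib complex_eq_iff)
  have scale: "f (scl c x) = c * f x" for c x
  proof -
    have c: "c = of_real (Re c) + of_real (Im c) * \<i>"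
      by (simp add: complex_eq_iff)
    have 1: "scl c x = Re c *\<^sub>R x + Im c *\<^sub>R scl \<i> x"
      by (subst c) (simp add: scale_left_distrib scale_of_real flip: scale_scale)
    have ic: "\<i> * c = of_real (- Im c) + of_real (Re c) * \<i>"
      by (simp add: complex_eq_iff)
    have 2: "scl \<i> (scl c x) = (- Im c) *\<^sub>R x + Re c *\<^sub>R scl \<i> x"
      unfolding scale_scale ic
      by (simp only: scale_left_distrib scale_of_real flip: scale_scale)
    show ?thesis
      \<comment> \<open>Fact \<open>2\<close> comes first because rewriting with \<open>1\<close>
        would destroy its left-hand side.\<close>
      unfolding f_def 2 unfolding 1
      by (simp add: linear_add[OF u(1)] linear_scale[OF u(1)] linear_diff[OF u(1)]
          complex_eq_iff algebra_simps del: scale_scale)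
  qed
  have norm_le: "norm (f x) \<le> norm x" for x
  proof (cases "f x = 0")
    case False
    \<comment> \<open>The unimodular \<open>c\<close> rotates \<open>f x\<close> onto the positive
      real axis, so that its modulus is the value of \<open>u\<close> at
      \<open>scl c x\<close>.\<close>
    define c where "c = cnj (sgn (f x))"
    have "c * f x = of_real (norm (f x))"
      using False by (simp add: c_def sgn_div_norm scaleR_conv_of_real complex_norm_square[symmetric]
          field_simps power2_eq_square)
    then have "norm (f x) = Re (f (scl c x))" by (simp add: scale)
    also have "\<dots> \<le> norm (scl c x)"
      using u(2)[of "scl c x"] by (simp add: f_def)
    also have "\<dots> = norm x"
      using False by (simp add: norm_scale c_def norm_sgn)
    finally show ?thesis .
  qed simp
  have "bounded_linear f"
  proof (rule bounded_linear_intro[where K = 1])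
    show "f (r *\<^sub>R x) = r *\<^sub>R f x" for r x
      using scale[of "of_real r" x] by (simp add: scale_of_real scaleR_conv_of_real)
  qed (auto simp: add norm_le)
  then have app: "blinfun_apply (Blinfun f) = f"
    by (rule bounded_linear_Blinfun_apply)
  have "norm v \<le> norm (f v)"
    using abs_Re_le_cmod[of "f v"] by (simp add: f_def u(3))
  moreover have "Vector_Spaces.linear scl (*) f"
    using vector_space_axioms vector_space_over_itself.vector_space_axioms
    by (auto simp: Vector_Spaces.linear_iff add scale)
  ultimately show "\<exists>f \<in> dual_space scl. norm f \<le> 1 \<and> norm v \<le> norm (blinfun_apply f v)"
    using norm_le
    by (intro bexI[of _ "Blinfun f"]) (auto simp: dual_space_def app intro!: norm_blinfun_bound)
qed

section \<open>Compactness of the joint image of the unit ball\<close>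

text \<open>Tychonoff's theorem: the set is a product of closed balls, each compact because
  \<open>'k\<close> is \<open>heine_borel\<close>.\<close>

lemma compact_Collect_norm_le:
  "compact {\<phi> :: 'a \<Rightarrow> 'k::{real_normed_vector, heine_borel}. \<forall>f. norm (\<phi> f) \<le> B f}"
proof -
  have "compactin (product_topology (\<lambda>_. euclidean) UNIV) (PiE UNIV (\<lambda>f. cball (0::'k) (B f)))"
    by (subst compactin_PiE) auto
  moreover have "PiE UNIV (\<lambda>f. cball (0::'k) (B f)) = {\<phi> :: 'a \<Rightarrow> 'k. \<forall>f. norm (\<phi> f) \<le> B f}"
    by auto
  ultimately show ?thesis by (simp add: euclidean_product_topology)
qed

text \<open>
  The image is the projection of a compact set of triples \<open>(T x, A x, \<phi>)\<close>, \<open>\<phi>\<close> in the unit ball of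
  the bidual, which is compact by Tychonoff; reflexivity turns \<open>\<phi>\<close> back into a point of the ball.
\<close>

lemma compact_image_cball_pair:
  fixes sX :: "'k::{real_normed_field, heine_borel} \<Rightarrow> 'a::real_normed_vector \<Rightarrow> 'a"
    and sY :: "'k \<Rightarrow> 'b::real_normed_vector \<Rightarrow> 'b"
    and T A :: "'a \<Rightarrow>\<^sub>L 'b"
  assumes X: "norming_dual sX" and Y: "norming_dual sY" "normed_space_over sY"
    and refl: "reflexive_space sX"
    and T: "Vector_Spaces.linear sX sY T" "compact_operator T"
    and A: "Vector_Spaces.linear sX sY A" "compact_operator A"
  shows "compact ((\<lambda>x. (T x, A x)) ` cball 0 1)"
proof -
  let ?B = "cball (0::'a) 1"
  define P where "P = {\<phi> :: ('a \<Rightarrow>\<^sub>L 'k) \<Rightarrow> 'k. \<forall>f. norm (\<phi> f) \<le> norm f}"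
  \<comment> \<open>The last two conditions tie one \<open>\<phi>\<close> to both \<open>y\<close>
    and \<open>z\<close>, so that a single point will represent both. Linearity is imposed on all
    real-linear \<open>f\<close>, which evaluations at points satisfy. Each condition is an equation
    between continuous functions of the triple, hence closed.\<close>
  define D where "D = {(y :: 'b, z :: 'b, \<phi> :: ('a \<Rightarrow>\<^sub>L 'k) \<Rightarrow> 'k).
    (\<forall>f g. \<phi> (f + g) = \<phi> f + \<phi> g) \<and> (\<forall>c f. \<phi> (op_scale (*) c f) = c * \<phi> f) \<and>
    (\<forall>g. \<phi> (g o\<^sub>L T) = blinfun_apply g y) \<and> (\<forall>g. \<phi> (g o\<^sub>L A) = blinfun_apply g z)}"
  define K where "K = (closure (T ` ?B) \<times> closure (A ` ?B) \<times> P) \<inter> D"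
  have "compact P"
    unfolding P_def by (rule compact_Collect_norm_le)
  moreover have "compact (closure (T ` ?B))" "compact (closure (A ` ?B))"
    using T(2) A(2) bounded_cball unfolding compact_operator_def by blast+
  moreover have "closed D"
    unfolding D_def case_prod_unfold
    by (intro closed_Collect_conj closed_Collect_all closed_Collect_eq continuous_intros
        continuous_on_compose2[OF continuous_on_product_coordinates]) auto
  ultimately have K: "compact K"
    unfolding K_def by (intro compact_Int_closed compact_Times)
  have image: "(\<lambda>(y, z, \<phi>). (y, z)) ` K = (\<lambda>x. (T x, A x)) ` ?B"
  proof (intro equalityI subsetI)
    fix w assume "w \<in> (\<lambda>x. (T x, A x)) ` ?B"
    then obtain x where x: "x \<in> ?B" "w = (T x, A x)" by blast
    have "norm (blinfun_apply f x) \<le> norm f" for f :: "'a \<Rightarrow>\<^sub>L 'k"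
      using norm_blinfun[of f x] mult_left_mono[of "norm x" 1 "norm f"] x(1) by simp
    then have "(T x, A x, \<lambda>f. blinfun_apply f x) \<in> K"
      using x(1)
      by (auto intro!: closure_subset[THEN subsetD] simp: K_def P_def D_def blinfun.add_left
          normed_space_over.blinfun_apply_op_scale[OF normed_space_over_mult])
    then show "w \<in> (\<lambda>(y, z, \<phi>). (y, z)) ` K"
      using x(2) by (intro image_eqI) auto
  next
    fix w assume "w \<in> (\<lambda>(y, z, \<phi>). (y, z)) ` K"
    then obtain y z \<phi> where w: "w = (y, z)" and P: "\<phi> \<in> P" and D: "(y, z, \<phi>) \<in> D"
      by (auto simp: K_def)
    have "bidual_functional sX \<phi>"
      using P D unfolding bidual_functional_def P_def D_def
      by (auto intro!: exI[of _ 1])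
    with refl obtain x where x: "\<And>f. f \<in> dual_space sX \<Longrightarrow> \<phi> f = blinfun_apply f x"
      unfolding reflexive_space_def by blast
    \<comment> \<open>The norming functional \<open>g\<close> of \<open>S x - y'\<close> detects any
      difference, while \<open>g o\<^sub>L S\<close> lies in the dual, where \<open>\<phi>\<close>
      is evaluation at \<open>x\<close>.\<close>
    have eq: "S x = y'"
      if S: "Vector_Spaces.linear sX sY S" and "\<And>g. \<phi> (g o\<^sub>L S) = blinfun_apply g y'"
      for S :: "'a \<Rightarrow>\<^sub>L 'b" and y'
    proof -
      obtain g where g: "g \<in> dual_space sY" "norm (S x - y') \<le> norm (blinfun_apply g (S x - y'))"
        using Y(1) unfolding norming_dual_def by blast
      have "g o\<^sub>L S \<in> dual_space sX"
        using S g(1) Vector_Spaces.linear_compose[of sX sY S "(*)" g]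
        by (auto simp: dual_space_def blinfun_compose.rep_eq)
      then have "blinfun_apply g (S x) = blinfun_apply g y'"
        using x[of "g o\<^sub>L S"] that(2)[of g] by simp
      then show ?thesis
        using g(2) by (simp add: blinfun.diff_right)
    qed
    have "T x = y" "A x = z"
      using D eq[OF T(1), of y] eq[OF A(1), of z] by (simp_all add: D_def)
    \<comment> \<open>Reflexivity alone does not place \<open>x\<close> in the ball; a norming
      functional carries the bound on \<open>\<phi>\<close> over to \<open>x\<close>.\<close>
    moreover have "norm x \<le> 1"
    proof -
      obtain f where f: "f \<in> dual_space sX" "norm f \<le> 1" "norm x \<le> norm (blinfun_apply f x)"
        using X unfolding norming_dual_def by blast
      have "norm (\<phi> f) \<le> norm f" using P by (simp add: P_def)
      then show ?thesis using f x[OF f(1)] by simp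
    qed
    ultimately show "w \<in> (\<lambda>x. (T x, A x)) ` ?B"
      using w by (intro image_eqI[of _ _ x]) auto
  qed
  have "continuous_on K (\<lambda>(y, z, \<phi>). (y, z))"
    unfolding case_prod_unfold by (intro continuous_intros)
  from compact_continuous_image[OF this K] show ?thesis
    unfolding image .
qed

section \<open>Near-maximisers of perturbed operators\<close>

text \<open>The short step is the convex combination of \<open>p\<close> and \<open>p + q\<close>
  with weights \<open>1 - 1 / n\<close> and \<open>1 / n\<close>. Multiplying by \<open>n\<close>
  turns the loss \<open>1 / n\<^sup>2\<close> into \<open>1 / n\<close>, which still vanishes in the
  limit.\<close>

lemma norm_add_ge_of_convexity:
  fixes p q :: "'a::real_normed_vector"
  assumes "norm p \<le> M" and "1 \<le> n" and "M - 1 / n\<^sup>2 \<le> norm (p + (1 / n) *\<^sub>R q)"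
  shows "M - 1 / n \<le> norm (p + q)"
proof -
  have n: "n > 0" using assms(2) by simp
  have "p + (1 / n) *\<^sub>R q = (1 - 1 / n) *\<^sub>R p + (1 / n) *\<^sub>R (p + q)"
    by (simp add: algebra_simps)
  then have "norm (p + (1 / n) *\<^sub>R q) \<le> norm ((1 - 1 / n) *\<^sub>R p) + norm ((1 / n) *\<^sub>R (p + q))"
    by (metis norm_triangle_ineq)
  also have "\<dots> = (1 - 1 / n) * norm p + (1 / n) * norm (p + q)"
    using assms(2) by simp
  also have "\<dots> \<le> (1 - 1 / n) * M + (1 / n) * norm (p + q)"
    using assms(1,2) by (intro add_right_mono mult_left_mono) auto
  finally have "M - 1 / n\<^sup>2 \<le> (1 - 1 / n) * M + (1 / n) * norm (p + q)"
    using assms(3) by simp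
  then have "n * (M - 1 / n\<^sup>2) \<le> n * ((1 - 1 / n) * M + (1 / n) * norm (p + q))"
    using n by (intro mult_left_mono) auto
  moreover have "n * (M - 1 / n\<^sup>2) = n * M - 1 / n"
    using n by (simp add: field_simps power2_eq_square)
  moreover have "n * ((1 - 1 / n) * M + (1 / n) * norm (p + q)) = n * M - M + norm (p + q)"
    using n by (simp add: field_simps)
  ultimately show ?thesis by simp
qed

text \<open>Points of the ball where \<open>T + (1 / n) C\<close> has norm at least
  \<open>norm T - 1 / n\<^sup>2\<close> have images under \<open>T\<close> and \<open>C\<close> that
  jointly accumulate at the images of one point; the points themselves need not converge.\<close>

lemma exists_norm_attaining_direction:
  fixes T C :: "'a::real_normed_vector \<Rightarrow>\<^sub>L 'b::real_normed_vector"
  assumes K: "compact ((\<lambda>x. (T x, C x)) ` cball 0 1)"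
    and ge: "\<And>r::real. norm T \<le> norm (T + r *\<^sub>R C)"
  obtains x where "norm x \<le> 1" "norm (T x) = norm T" "norm T \<le> norm (T x + C x)"
proof -
  \<comment> \<open>The shift by \<open>Suc\<close> avoids division by zero and gives the bound
    \<open>1 \<le> N n\<close> needed for convexity.\<close>
  define N where "N n = real (Suc n)" for n
  have N: "N n \<ge> 1" "N n > 0" for n by (auto simp: N_def)
  have "\<exists>x. norm x \<le> 1 \<and> norm T - 1 / (N n)\<^sup>2 \<le> norm (T x + (1 / N n) *\<^sub>R C x)" for n
  proof (rule ccontr)
    let ?S = "T + (1 / N n) *\<^sub>R C" and ?m = "norm T - 1 / (N n)\<^sup>2"
    assume "\<not> ?thesis"
    then have *: "norm (?S x) \<le> ?m" if "norm x \<le> 1" for x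
      using that by (force simp: blinfun.add_left blinfun.scaleR_left)
    \<comment> \<open>Evaluating at \<open>0\<close> yields the nonnegativity that the operator norm
      bound requires.\<close>
    have m: "0 \<le> ?m"
      using *[of 0] by simp
    have "norm ?S \<le> ?m"
    proof (rule norm_blinfun_bound[OF m])
      fix x
      show "norm (?S x) \<le> ?m * norm x"
      proof (cases "x = 0")
        case False
        then show ?thesis
          using *[of "x /\<^sub>R norm x"] by (simp add: blinfun.scaleR_right field_simps)
      qed simp
    qed
    with ge[of "1 / N n"] show False
      using N(2)[of n] by (smt (verit) divide_pos_pos zero_less_power)
  qed
  then obtain x where x: "\<And>n. norm (x n) \<le> 1"
      "\<And>n. norm T - 1 / (N n)\<^sup>2 \<le> norm (T (x n) + (1 / N n) *\<^sub>R C (x n))"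
    by metis
  have "(T (x n), C (x n)) \<in> (\<lambda>x. (T x, C x)) ` cball 0 1" for n
    using x(1) by auto
  then obtain w s where w: "w \<in> (\<lambda>x. (T x, C x)) ` cball 0 1" and s: "strict_mono s"
    and lim: "((\<lambda>n. (T (x n), C (x n))) \<circ> s) \<longlonglongrightarrow> w"
    using K unfolding compact_def by (metis (lifting))
  obtain a where a: "norm a \<le> 1" "w = (T a, C a)" using w by auto
  have limT: "(\<lambda>n. T (x (s n))) \<longlonglongrightarrow> T a" and limC: "(\<lambda>n. C (x (s n))) \<longlonglongrightarrow> C a"
    using tendsto_fst[OF lim] tendsto_snd[OF lim] by (auto simp: a(2) o_def)
  have bound: "norm (T y) \<le> norm T" if "norm y \<le> 1" for y
    using norm_blinfun[of T y] mult_left_mono[of "norm y" 1 "norm T"] that by simp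
  have inv: "(\<lambda>n. 1 / N (s n)) \<longlonglongrightarrow> 0"
    using LIMSEQ_subseq_LIMSEQ[OF lim_1_over_n[THEN LIMSEQ_Suc] s] by (simp add: N_def o_def)
  have inv2: "(\<lambda>n. 1 / (N (s n))\<^sup>2) \<longlonglongrightarrow> 0"
    using tendsto_power[OF inv, of 2] by (simp add: power_divide)
  \<comment> \<open>The perturbation vanishes in this limit, so \<open>a\<close> attains the norm of
    \<open>T\<close>.\<close>
  have "norm T - 0 \<le> norm (T a + 0 *\<^sub>R C a)"
    by (rule LIMSEQ_le[OF tendsto_diff[OF tendsto_const inv2]
          tendsto_norm[OF tendsto_add[OF limT tendsto_scaleR[OF inv limC]]]])
      (use x(2) in auto)
  then have 1: "norm (T a) = norm T"
    using bound[OF a(1)] by simp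
  \<comment> \<open>Convexity first replaces the step \<open>1 / N n\<close> by the full step, so
    \<open>C a\<close> survives in the limit.\<close>
  have "norm T - 0 \<le> norm (T a + C a)"
    by (rule LIMSEQ_le[OF tendsto_diff[OF tendsto_const inv] tendsto_norm[OF tendsto_add[OF limT limC]]])
      (use norm_add_ge_of_convexity[OF bound[OF x(1)] N(1) x(2)] in auto)
  with 1 a(1) show thesis using that by simp
qed

section \<open>Orthogonality at norm-attaining points\<close>

text \<open>Compactness only delivers points of the closed ball; for \<open>T \<noteq> 0\<close>,
  attaining the norm forces them onto the sphere.\<close>

lemma norm_attainment_set_memI:
  assumes "T \<noteq> 0" and "norm x \<le> 1" and "norm (blinfun_apply T x) = norm T"
  shows "x \<in> norm_attainment_set T"
proof -
  have "norm T \<le> norm T * norm x"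
    using norm_blinfun[of T x] assms(3) by simp
  then have "1 \<le> norm x"
    using assms(1) by simp
  with assms show ?thesis by (simp add: norm_attainment_set_def)
qed

text \<open>
  Scaling \<open>A\<close> by \<open>c\<close>, near-maximisers of \<open>T + (c/n) A\<close> accumulate at a point of \<open>M\<^sub>T\<close> which witnesses
  the inequality for this \<open>c\<close>. It may depend on \<open>c\<close>, but only by a unimodular factor.
\<close>

lemma birkhoff_orth_iff_orth_set:
  fixes sX :: "'k::{real_normed_field, heine_borel} \<Rightarrow> 'a::real_normed_vector \<Rightarrow> 'a"
    and sY :: "'k \<Rightarrow> 'b::real_normed_vector \<Rightarrow> 'b"
    and T A :: "'a \<Rightarrow>\<^sub>L 'b"
  assumes X: "norming_dual sX" and Y: "norming_dual sY" "normed_space_over sY"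
    and refl: "reflexive_space sX"
    and T: "Vector_Spaces.linear sX sY T" "compact_operator T"
    and A: "Vector_Spaces.linear sX sY A" "compact_operator A"
    and x0: "x0 \<in> norm_attainment_set T"
    and M: "\<And>x. x \<in> norm_attainment_set T \<Longrightarrow> \<exists>u. norm u = 1 \<and> x = sX u x0"
  shows "birkhoff_orth (op_scale sY) T A \<longleftrightarrow> orth_set sY T A \<inter> norm_attainment_set T \<noteq> {}"
proof
  interpret Y: normed_space_over sY by fact
  assume orth: "birkhoff_orth (op_scale sY) T A"
  have x0': "norm x0 = 1" "norm (T x0) = norm T"
    using x0 by (auto simp: norm_attainment_set_def)
  have "norm (T x0) \<le> norm (T x0 + sY c (A x0))" for c
  proof (cases "T = 0")
    case False
    \<comment> \<open>Absorbing \<open>c\<close> into the operator leaves only real multiples of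
      \<open>C\<close> to consider.\<close>
    define C where "C = op_scale sY c A"
    have C: "C x = sY c (A x)" for x
      by (simp add: C_def Y.blinfun_apply_op_scale)
    have "compact ((\<lambda>(y, z). (y, sY c z)) ` (\<lambda>x. (T x, A x)) ` cball 0 1)"
    proof (rule compact_continuous_image[OF _ compact_image_cball_pair[OF X Y refl T A]])
      show "continuous_on S (\<lambda>(y, z). (y, sY c z))" for S
        unfolding case_prod_unfold
        by (intro continuous_intros bounded_linear.continuous_on[OF Y.bounded_linear_scale])
    qed
    then have K: "compact ((\<lambda>x. (T x, C x)) ` cball 0 1)"
      by (simp add: image_image C)
    have "norm T \<le> norm (T + r *\<^sub>R C)" for r
    proof -
      have "r *\<^sub>R C = op_scale sY (of_real r * c) A"
        by (rule blinfun_eqI)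
          (simp add: C Y.blinfun_apply_op_scale blinfun.scaleR_left Y.scale_of_real flip: Y.scale_scale)
      then show ?thesis using orth by (simp add: birkhoff_orth_def)
    qed
    then obtain x where x: "norm x \<le> 1" "norm (T x) = norm T" "norm T \<le> norm (T x + C x)"
      using exists_norm_attaining_direction[OF K] by blast
    obtain u where u: "norm u = 1" "x = sX u x0"
      using M norm_attainment_set_memI[OF False x(1,2)] by blast
    \<comment> \<open>The factor \<open>u\<close> comes out of the whole sum and has norm 1, so the
      inequality passes to \<open>x0\<close>, which is the same for every \<open>c\<close>.\<close>
    have "T x + C x = sY u (T x0 + sY c (A x0))"
      using T(1) A(1) by (simp add: C u(2) Vector_Spaces.linear_iff Y.scale_right_distrib mult.commute)
    then show ?thesis
      using x(3) u(1) x0'(2) by (simp add: Y.norm_scale)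
  qed simp
  then show "orth_set sY T A \<inter> norm_attainment_set T \<noteq> {}"
    using x0 x0'(1) by (auto simp: orth_set_def birkhoff_orth_def)
next
  interpret Y: normed_space_over sY by fact
  assume "orth_set sY T A \<inter> norm_attainment_set T \<noteq> {}"
  then obtain x where x: "norm x = 1" "norm (T x) = norm T"
      "\<forall>c. norm T \<le> norm (T x + sY c (A x))"
    by (auto simp: orth_set_def birkhoff_orth_def norm_attainment_set_def)
  have "norm (T x + sY c (A x)) \<le> norm (T + op_scale sY c A)" for c
    using norm_blinfun[of "T + op_scale sY c A" x] x(1)
    by (simp add: blinfun.add_left Y.blinfun_apply_op_scale)
  then show "birkhoff_orth (op_scale sY) T A"
    using x(3) unfolding birkhoff_orth_def by (metis order_trans)
qed

section \<open>The real and complex cases\<close>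

theorem theorem3p1:
  shows
    "(\<forall>(T :: 'a::banach \<Rightarrow>\<^sub>L 'b::banach) (A :: 'a \<Rightarrow>\<^sub>L 'b) (x0 :: 'a).
        reflexive_space (scaleR :: real \<Rightarrow> 'a \<Rightarrow> 'a) \<longrightarrow>
        compact_operator T \<longrightarrow>
        compact_operator A \<longrightarrow>
        x0 \<in> sphere 0 1 \<longrightarrow>
        norm_attainment_set T = {x0, - x0} \<longrightarrow>
        (birkhoff_orth (scaleR :: real \<Rightarrow> _) T A \<longleftrightarrow>
          orth_set (scaleR :: real \<Rightarrow> _) T A \<inter> norm_attainment_set T \<noteq> {}))
     \<and>
     (\<forall>(scaleX :: complex \<Rightarrow> 'c::banach \<Rightarrow> 'c) (scaleY :: complex \<Rightarrow> 'd::banach \<Rightarrow> 'd)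
        (T :: 'c \<Rightarrow>\<^sub>L 'd) (A :: 'c \<Rightarrow>\<^sub>L 'd) (x0 :: 'c).
        normed_space_over scaleX \<longrightarrow>
        normed_space_over scaleY \<longrightarrow>
        reflexive_space scaleX \<longrightarrow>
        Vector_Spaces.linear scaleX scaleY (blinfun_apply T) \<longrightarrow>
        Vector_Spaces.linear scaleX scaleY (blinfun_apply A) \<longrightarrow>
        compact_operator T \<longrightarrow>
        compact_operator A \<longrightarrow>
        x0 \<in> sphere 0 1 \<longrightarrow>
        norm_attainment_set T = {scaleX (exp (\<i> * of_real \<theta>)) x0 | \<theta>. \<theta> \<in> {0..<2 * pi}} \<longrightarrow>
        (birkhoff_orth (op_scale scaleY) T A \<longleftrightarrow>
          orth_set scaleY T A \<inter> norm_attainment_set T \<noteq> {}))"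
proof (intro conjI allI impI)
  fix T A :: "'a \<Rightarrow>\<^sub>L 'b" and x0 :: 'a
  assume refl: "reflexive_space (scaleR :: real \<Rightarrow> 'a \<Rightarrow> 'a)"
    and T: "compact_operator T" and A: "compact_operator A"
    and M: "norm_attainment_set T = {x0, - x0}"
  have lin: "Vector_Spaces.linear (scaleR :: real \<Rightarrow> 'a \<Rightarrow> 'a) scaleR S" for S :: "'a \<Rightarrow>\<^sub>L 'b"
    using bounded_linear.linear[OF blinfun.bounded_linear_right] by (simp add: linear_def)
  \<comment> \<open>Over the reals the induced scalar multiplication is the built-in one, which
    reconciles the general equivalence with the stated form.\<close>
  have "op_scale (scaleR :: real \<Rightarrow> 'b \<Rightarrow> 'b) = (scaleR :: real \<Rightarrow> ('a \<Rightarrow>\<^sub>L 'b) \<Rightarrow> _)"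
    by (intro ext blinfun_eqI)
      (simp add: normed_space_over.blinfun_apply_op_scale[OF normed_space_over_scaleR] blinfun.scaleR_left)
  moreover have "\<exists>u. norm u = 1 \<and> x = u *\<^sub>R x0" if "x \<in> norm_attainment_set T" for x
    using that M by (auto intro: exI[of _ 1] exI[of _ "- 1"])
  ultimately show "birkhoff_orth (scaleR :: real \<Rightarrow> _) T A \<longleftrightarrow>
      orth_set (scaleR :: real \<Rightarrow> _) T A \<inter> norm_attainment_set T \<noteq> {}"
    using birkhoff_orth_iff_orth_set[OF norming_dual_real norming_dual_real normed_space_over_scaleR
        refl lin T lin A, of x0] M by auto
next
  fix scaleX :: "complex \<Rightarrow> 'c \<Rightarrow> 'c" and scaleY :: "complex \<Rightarrow> 'd \<Rightarrow> 'd"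
    and T A :: "'c \<Rightarrow>\<^sub>L 'd" and x0 :: 'c
  assume X: "normed_space_over scaleX" and Y: "normed_space_over scaleY"
    and refl: "reflexive_space scaleX"
    and T: "Vector_Spaces.linear scaleX scaleY T" "compact_operator T"
    and A: "Vector_Spaces.linear scaleX scaleY A" "compact_operator A"
    and M: "norm_attainment_set T = {scaleX (exp (\<i> * of_real \<theta>)) x0 | \<theta>. \<theta> \<in> {0..<2 * pi}}"
  interpret X: normed_space_over scaleX by fact
  \<comment> \<open>The angle 0 belongs to the half-open interval, so \<open>x0\<close> itself
    attains the norm.\<close>
  have "x0 = scaleX (exp (\<i> * of_real 0)) x0" by simp
  then have "x0 \<in> norm_attainment_set T"
    unfolding M by (auto intro!: exI[of _ 0])
  moreover have "\<exists>u. norm u = 1 \<and> x = scaleX u x0" if "x \<in> norm_attainment_set T" for x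
    using that norm_exp_i_times unfolding M by blast
  ultimately show "birkhoff_orth (op_scale scaleY) T A \<longleftrightarrow>
      orth_set scaleY T A \<inter> norm_attainment_set T \<noteq> {}"
    by (rule birkhoff_orth_iff_orth_set[OF norming_dual_complex[OF X] norming_dual_complex[OF Y] Y
        refl T A])
qed

end
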